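(* Let $N=1$. The SGSWLME system $\partial_t\boldsymbol{\hat W}+A_{\text{SGSWLME}}(\boldsymbol{\hat W})\,\partial_x\boldsymbol{\hat W}=\boldsymbol{\hat S}(\boldsymbol{\hat W})$ defined in the context is hyperbolic for a friction coefficient $\nu\sim\mathcal{U}(\mu-\sigma,\mu+\sigma)$ (uniform) and for $\nu\sim\mathcal{N}(\mu,\sigma)$ (normal), for stochastic Galerkin orders $K$ up to $K=10$, if for $K>1$ the system matrix $A_{\text{SGSWLME}}(\boldsymbol{\hat W})$ is linearised by setting $\hat h_j=0$, $\hat q_{0,j}=0$ and $\hat q_{1,j}=0$ for all $j\ge1$ in it.
   Context: Write $\nu=\mu+\sigma\xi$, where $\xi$ is uniform on $[-1,1]$ (uniform case) or standard normal (normal case). Let $\psi_0,\psi_1,\ldots$ be the polynomials orthonormal with respect to the distribution of $\xi$ ($\deg\psi_k=k$; normalised Legendre, respectively normalised Hermite polynomials), with $\langle\cdot\rangle$ denoting expectation. They satisfy a three-term recurrence $\psi_{k+1}(\xi)=(\alpha_k\xi+\beta_k)\psi_k(\xi)+\gamma_k\psi_{k-1}(\xi)$ with $\alpha_k\neq0$ and $\psi_{-1}=0$. For $k=0,\ldots,K$ let $(\mathcal{M}_k)_{lm}=\langle\psi_k\psi_l\psi_m\rangle$, $0\le l,m\le K$. For $\boldsymbol{\hat\eta}=(\hat\eta_0,\ldots,\hat\eta_K)^T\in\mathbb{R}^{K+1}$ let $\mathcal{P}(\boldsymbol{\hat\eta})=\sum_{k=0}^K\hat\eta_k\mathcal{M}_k$.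 The state is $\boldsymbol{\hat W}=(\boldsymbol{\hat h},\boldsymbol{\hat q_0},\boldsymbol{\hat q_1})^T$ with $\boldsymbol{\hat h}=(\hat h_0,\ldots,\hat h_K)^T$ and $\boldsymbol{\hat q_i}=(\hat q_{i,0},\ldots,\hat q_{i,K})^T$ in $\mathbb{R}^{K+1}$. It is assumed that $\mathcal{P}(\boldsymbol{\hat h})$ is invertible, and $\boldsymbol{\hat u_i}=\mathcal{P}(\boldsymbol{\hat h})^{-1}\boldsymbol{\hat q_i}$. Abbreviate $H=\mathcal{P}(\boldsymbol{\hat h})$, $Q_i=\mathcal{P}(\boldsymbol{\hat q_i})$, $U_i=\mathcal{P}(\boldsymbol{\hat u_i})$, let $O,I$ be the zero and identity matrices of size $K+1$, and let $g$ be the gravitational constant. For $N=1$ the system matrix of the stochastic Galerkin shallow water linearised moment equations (SGSWLME) is the $3(K+1)\times3(K+1)$ matrix $$A_{\text{SGSWLME}}(\boldsymbol{\hat W})=\begin{pmatrix}O&I&O\\ gH-Q_0H^{-1}U_0-\tfrac13Q_1H^{-1}U_1 & Q_0H^{-1}+U_0 & \tfrac13\left(Q_1H^{-1}+U_1\right)\\ -Q_0H^{-1}U_1-Q_1H^{-1}U_0 & Q_1H^{-1}+U_1 & Q_0H^{-1}\end{pmatrix}.$$ The friction source term is $$\boldsymbol{\hat S}(\boldsymbol{\hat W})=\begin{pmatrix}\boldsymbol 0\\ -\tfrac1\lambda T(\boldsymbol{\hat u_0}+\boldsymbol{\hat u_1})\\ -\tfrac3\lambda T(\boldsymbol{\hat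 u_0}+\boldsymbol{\hat u_1})-12\,T H^{-1}\boldsymbol{\hat u_1}\end{pmatrix},$$ where $\lambda$ is the slip length and $T$ is the $(K+1)\times(K+1)$ tridiagonal matrix (indices $0,\ldots,K$) with $T_{k,k}=\mu-\sigma\beta_k/\alpha_k$, $T_{k+1,k}=\sigma/\alpha_k$, $T_{k-1,k}=-\sigma\gamma_k/\alpha_k$, and zero otherwise; it contains no derivatives of $\boldsymbol{\hat W}$. A first-order system with system matrix $A(\boldsymbol{\hat W})$ is called hyperbolic if $A(\boldsymbol{\hat W})$ is diagonalisable with real eigenvalues for all states $\boldsymbol{\hat W}$.
   Formalization: States are required to have P(ĥ) positive definite (positive water height), not merely invertible, and g, σ, λ are taken positive; with invertibility alone the claim fails, e.g. K=0, ĥ₀<0 (with ψ₀=1), zero discharges gives eigenvalues ±√(gĥ₀), which are not real. *)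

theory Defs
  imports
    "HOL-Probability.Distributions"
    "Jordan_Normal_Form.Char_Poly"
    "Jordan_Normal_Form.Gauss_Jordan_Elimination"
begin

hide_const (open) Finite_Cartesian_Product.vec Finite_Cartesian_Product.mat
no_notation Finite_Cartesian_Product.vec_nth (infixl "$" 90)
no_notation inner (infix "\<bullet>" 70)

section \<open>First-order systems and hyperbolicity\<close>

text \<open>
  The system \<open>\<partial>\<^sub>t W + A(W) \<partial>\<^sub>x W = S(W)\<close>, for \<open>W\<close> taking values in the set \<open>states\<close>.
\<close>

record first_order_system =
  states :: "real vec set"
  system_matrix :: "real vec \<Rightarrow> real mat"
  source_term :: "real vec \<Rightarrow> real vec"

text \<open>
  Eigenvalues and diagonalisability of a real matrix are taken over the complex numbers, so that
  realness of the eigenvalues is a genuine condition.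
\<close>

definition diagonalisable :: "complex mat \<Rightarrow> bool" where
  "diagonalisable A \<longleftrightarrow> (\<exists>D. diagonal_mat D \<and> similar_mat A D)"

definition hyperbolic :: "first_order_system \<Rightarrow> bool" where
  "hyperbolic sys \<longleftrightarrow>
     (\<forall>W \<in> states sys.
        let A = map_mat complex_of_real (system_matrix sys W) in
        diagonalisable A \<and> (\<forall>z. eigenvalue A z \<longrightarrow> z \<in> \<real>))"

section \<open>Polynomial chaos basis\<close>

text \<open>
  Orthonormality with respect to the law of \<open>\<xi>\<close> and \<open>deg \<psi>\<^sub>k = k\<close> determine each \<open>\<psi>\<^sub>k\<close> up to sign;
  the choice with positive leading coefficients gives the normalised Legendre
  (probabilists' Hermite) polynomials for uniform (standard normal) \<open>\<xi>\<close>.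
\<close>

definition orthonormal_polys ::
    "'a measure \<Rightarrow> ('a \<Rightarrow> real) \<Rightarrow> (nat \<Rightarrow> real poly) \<Rightarrow> bool" where
  "orthonormal_polys M \<xi> \<psi> \<longleftrightarrow>
     (\<forall>k. Polynomial.degree (\<psi> k) = k) \<and>
     (\<forall>k l. (\<integral>\<omega>. poly (\<psi> k) (\<xi> \<omega>) * poly (\<psi> l) (\<xi> \<omega>) \<partial>M) = (if k = l then 1 else 0))"

definition three_term_recurrence ::
    "(nat \<Rightarrow> real poly) \<Rightarrow> (nat \<Rightarrow> real) \<Rightarrow> (nat \<Rightarrow> real) \<Rightarrow> (nat \<Rightarrow> real) \<Rightarrow> bool" where
  "three_term_recurrence \<psi> \<alpha> \<beta> \<gamma> \<longleftrightarrow>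
     (\<forall>k. \<alpha> k \<noteq> 0 \<and>
        \<psi> (k + 1) = [:\<beta> k, \<alpha> k:] * \<psi> k + Polynomial.smult (\<gamma> k) (if k = 0 then 0 else \<psi> (k - 1)))"

section \<open>Galerkin matrices\<close>

definition triple_matrix ::
    "'a measure \<Rightarrow> ('a \<Rightarrow> real) \<Rightarrow> (nat \<Rightarrow> real poly) \<Rightarrow> nat \<Rightarrow> nat \<Rightarrow> real mat" where
  "triple_matrix M \<xi> \<psi> K k = Matrix.mat (K + 1) (K + 1) (\<lambda>(l, m).
     \<integral>\<omega>. poly (\<psi> k) (\<xi> \<omega>) * poly (\<psi> l) (\<xi> \<omega>) * poly (\<psi> m) (\<xi> \<omega>) \<partial>M)"

definition galerkin_matrix ::
    "'a measure \<Rightarrow> ('a \<Rightarrow> real) \<Rightarrow> (nat \<Rightarrow> real poly) \<Rightarrow> nat \<Rightarrow> real vec \<Rightarrow> real mat" where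
  "galerkin_matrix M \<xi> \<psi> K \<eta> = Matrix.mat (K + 1) (K + 1) (\<lambda>(l, m).
     \<Sum>k\<le>K. (\<eta> $ k) * (triple_matrix M \<xi> \<psi> K k $$ (l, m)))"

definition friction_matrix ::
    "real \<Rightarrow> real \<Rightarrow> (nat \<Rightarrow> real) \<Rightarrow> (nat \<Rightarrow> real) \<Rightarrow> (nat \<Rightarrow> real) \<Rightarrow> nat \<Rightarrow> real mat" where
  "friction_matrix \<mu> \<sigma> \<alpha> \<beta> \<gamma> K = Matrix.mat (K + 1) (K + 1) (\<lambda>(i, k).
     if i = k then \<mu> - \<sigma> * \<beta> k / \<alpha> k
     else if i = k + 1 then \<sigma> / \<alpha> k
     else if i + 1 = k then - \<sigma> * \<gamma> k / \<alpha> k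
     else 0)"

definition positive_definite :: "real mat \<Rightarrow> bool" where
  "positive_definite A \<longleftrightarrow>
     dim_row A = dim_col A \<and> transpose_mat A = A \<and>
     (\<forall>v \<in> carrier_vec (dim_row A). v \<noteq> 0\<^sub>v (dim_row A) \<longrightarrow> v \<bullet> (A *\<^sub>v v) > 0)"

text \<open>Unspecified when \<open>A\<close> is not invertible.\<close>

definition inv_mat :: "real mat \<Rightarrow> real mat" where
  "inv_mat A = the (mat_inverse A)"

definition block3_mat :: "nat \<Rightarrow> real mat list list \<Rightarrow> real mat" where
  "block3_mat n B = Matrix.mat (3 * n) (3 * n) (\<lambda>(i, j).
     (B ! (i div n) ! (j div n)) $$ (i mod n, j mod n))"

section \<open>The SGSWLME system of order one\<close>

text \<open>
  A state is the concatenation of the three coefficient vectors \<open>h\<close>, \<open>q\<^sub>0\<close>, \<open>q\<^sub>1\<close>, which are the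
  components 0, 1, 2.
\<close>

definition component :: "nat \<Rightarrow> nat \<Rightarrow> real vec \<Rightarrow> real vec" where
  "component K i W = Matrix.vec (K + 1) (\<lambda>k. W $ (i * (K + 1) + k))"

text \<open>
  Invertibility of \<open>P(h)\<close> alone does not give real wave speeds, already for \<open>K = 0\<close>, \<open>h < 0\<close> and
  \<open>q\<^sub>0 = q\<^sub>1 = 0\<close>. Positivity of the water height is expressed by positive definiteness of \<open>P(h)\<close>,
  which follows from positivity of \<open>\<Sum>\<^sub>k h\<^sub>k \<psi>\<^sub>k(\<xi>)\<close> almost surely, and amounts to \<open>h\<^sub>0 > 0\<close> when
  \<open>\<psi>\<^sub>0 = 1\<close> and all higher coefficients vanish.
\<close>

definition sgswlme_states ::
    "'a measure \<Rightarrow> ('a \<Rightarrow> real) \<Rightarrow> (nat \<Rightarrow> real poly) \<Rightarrow> nat \<Rightarrow> real vec set" where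
  "sgswlme_states M \<xi> \<psi> K =
     {W \<in> carrier_vec (3 * (K + 1)).
        let H = galerkin_matrix M \<xi> \<psi> K (component K 0 W) in
        invertible_mat H \<and> positive_definite H}"

definition sgswlme_matrix ::
    "'a measure \<Rightarrow> ('a \<Rightarrow> real) \<Rightarrow> (nat \<Rightarrow> real poly) \<Rightarrow> real \<Rightarrow> nat \<Rightarrow> real vec \<Rightarrow> real mat" where
  "sgswlme_matrix M \<xi> \<psi> g K W = (
     let h = component K 0 W; q0 = component K 1 W; q1 = component K 2 W;
         P = galerkin_matrix M \<xi> \<psi> K;
         H = P h; H' = inv_mat H;
         u0 = H' *\<^sub>v q0; u1 = H' *\<^sub>v q1;
         Q0 = P q0; Q1 = P q1; U0 = P u0; U1 = P u1;
         Z = 0\<^sub>m (K + 1) (K + 1); E = 1\<^sub>m (K + 1)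
     in block3_mat (K + 1)
       [[Z, E, Z],
        [g \<cdot>\<^sub>m H - Q0 * H' * U0 - (1/3) \<cdot>\<^sub>m (Q1 * H' * U1), Q0 * H' + U0, (1/3) \<cdot>\<^sub>m (Q1 * H' + U1)],
        [- (Q0 * H' * U1) - Q1 * H' * U0, Q1 * H' + U1, Q0 * H']])"

definition sgswlme_source ::
    "'a measure \<Rightarrow> ('a \<Rightarrow> real) \<Rightarrow> (nat \<Rightarrow> real poly) \<Rightarrow>
     (nat \<Rightarrow> real) \<Rightarrow> (nat \<Rightarrow> real) \<Rightarrow> (nat \<Rightarrow> real) \<Rightarrow>
     real \<Rightarrow> real \<Rightarrow> real \<Rightarrow> nat \<Rightarrow> real vec \<Rightarrow> real vec" where
  "sgswlme_source M \<xi> \<psi> \<alpha> \<beta> \<gamma> \<mu> \<sigma> slip K W = (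
     let H' = inv_mat (galerkin_matrix M \<xi> \<psi> K (component K 0 W));
         u0 = H' *\<^sub>v component K 1 W; u1 = H' *\<^sub>v component K 2 W;
         T = friction_matrix \<mu> \<sigma> \<alpha> \<beta> \<gamma> K
     in 0\<^sub>v (K + 1)
        @\<^sub>v (- (1 / slip)) \<cdot>\<^sub>v (T *\<^sub>v (u0 + u1))
        @\<^sub>v ((- (3 / slip)) \<cdot>\<^sub>v (T *\<^sub>v (u0 + u1)) - 12 \<cdot>\<^sub>v (T *\<^sub>v (H' *\<^sub>v u1))))"

definition sgswlme ::
    "'a measure \<Rightarrow> ('a \<Rightarrow> real) \<Rightarrow> (nat \<Rightarrow> real poly) \<Rightarrow>
     (nat \<Rightarrow> real) \<Rightarrow> (nat \<Rightarrow> real) \<Rightarrow> (nat \<Rightarrow> real) \<Rightarrow>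
     real \<Rightarrow> real \<Rightarrow> real \<Rightarrow> real \<Rightarrow> nat \<Rightarrow> first_order_system" where
  "sgswlme M \<xi> \<psi> \<alpha> \<beta> \<gamma> \<mu> \<sigma> slip g K =
     \<lparr> states = sgswlme_states M \<xi> \<psi> K,
       system_matrix = sgswlme_matrix M \<xi> \<psi> g K,
       source_term = sgswlme_source M \<xi> \<psi> \<alpha> \<beta> \<gamma> \<mu> \<sigma> slip K \<rparr>"

text \<open>Sets every coefficient of index at least 1 in \<open>h\<close>, \<open>q\<^sub>0\<close> and \<open>q\<^sub>1\<close> to zero.\<close>

definition drop_higher_modes :: "nat \<Rightarrow> real vec \<Rightarrow> real vec" where
  "drop_higher_modes K W =
     Matrix.vec (3 * (K + 1)) (\<lambda>i. if i mod (K + 1) = 0 then W $ i else 0)"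

definition linearised :: "nat \<Rightarrow> first_order_system \<Rightarrow> first_order_system" where
  "linearised K sys =
     sys \<lparr> system_matrix := (\<lambda>W. system_matrix sys (drop_higher_modes K W)) \<rparr>"

section \<open>Friction coefficient\<close>

definition uniform_friction :: "'a measure \<Rightarrow> ('a \<Rightarrow> real) \<Rightarrow> real \<Rightarrow> real \<Rightarrow> bool" where
  "uniform_friction M \<nu> \<mu> \<sigma> \<longleftrightarrow>
     distributed M lborel \<nu>
       (\<lambda>x. indicator {\<mu> - \<sigma>..\<mu> + \<sigma>} x / measure lborel {\<mu> - \<sigma>..\<mu> + \<sigma>})"

text \<open>Here \<open>\<sigma>\<close> is the standard deviation, since \<open>\<nu> = \<mu> + \<sigma> \<xi>\<close> with \<open>\<xi>\<close> standard normal.\<close>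

definition normal_friction :: "'a measure \<Rightarrow> ('a \<Rightarrow> real) \<Rightarrow> real \<Rightarrow> real \<Rightarrow> bool" where
  "normal_friction M \<nu> \<mu> \<sigma> \<longleftrightarrow> distributed M lborel \<nu> (normal_density \<mu> \<sigma>)"

end

(*
  All blocks of the system matrix are conjugated to diagonal matrices by one matrix R: for K = 1 the
  Galerkin matrices generate a commutative algebra, otherwise all blocks are scalar. The problem then
  splits into 3 x 3 matrices of the deterministic system with height h and moments u, v, whose
  eigenvalues are u, u + c, u - c with c^2 = g h + v^2 > 0. The eigenvectors
  (2v, 2uv, v^2 - 3gh) and (1, u +- c, 2v) have a determinant of modulus 6 c^3, so they always form
  a basis.
*)

theory Submission
  imports Defs
begin

text \<open>Diagonalising \<open>H\<close>, \<open>Q0\<close> and \<open>Q1\<close> by one matrix is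
  not enough: \<open>U0\<close> and \<open>U1\<close> are Galerkin matrices of the vectors H^-1 q_i,
  so the proof must also establish P(H^-1 q) = H^-1 P(q). For scalar blocks this is linearity of P.
  For K = 1 it holds because the eigenvalues of P(q) are, up to scaling, the coordinates of q in the
  common eigenbasis, on which H^-1 acts by division. It follows that Q_i H^-1 = U_i, which leaves
  only pointwise arithmetic in the eigenvalues. The splitting into 3 x 3 problems is carried out
  without permuting indices: the eigenvector matrix and its inverse are written down in the same
  block form, so every check reduces to a 3 x 3 identity for each mode.\<close>

section \<open>Real diagonalisation\<close>

text \<open>Embedding into the complex numbers preserves products and the identity, hence the
  similarity; the spectrum is then the diagonal of \<open>D\<close>, which consists of embedded
  reals.\<close>

lemma similar_real_diagonal_hyperbolic:
  fixes A D :: "real mat"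
  assumes sim: "similar_mat A D" and D: "diagonal_mat D"
  defines "C \<equiv> map_mat complex_of_real"
  shows "diagonalisable (C A)" and "eigenvalue (C A) z \<Longrightarrow> z \<in> \<real>"
proof -
  from sim obtain n P Q where c: "{A, D, P, Q} \<subseteq> carrier_mat n n"
    and i: "P * Q = 1\<^sub>m n" "Q * P = 1\<^sub>m n" "A = P * D * Q"
    by (auto dest: similar_matD)
  have CA: "C A \<in> carrier_mat n n" and CD: "C D \<in> carrier_mat n n"
    using c by (auto simp: C_def)
  note hom_mult = of_real_hom.mat_hom_mult[where 'a = complex, folded C_def]
  have "C A = C P * C D * C Q"
    using c hom_mult[of "P * D" n n Q n] hom_mult[of P n n D n] mult_carrier_mat[of P n n D n]
    by (simp add: i(3))
  moreover have "C P * C Q = 1\<^sub>m n" "C Q * C P = 1\<^sub>m n"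
    using c i(1,2) hom_mult[of P n n Q n] hom_mult[of Q n n P n]
    by (simp_all add: C_def of_real_hom.mat_hom_one)
  moreover have "C P \<in> carrier_mat n n" "C Q \<in> carrier_mat n n"
    using c by (auto simp: C_def)
  ultimately have CS: "similar_mat (C A) (C D)"
    using CA CD by (intro similar_matI[of _ _ "C P" "C Q" n]) auto
  have dD: "diagonal_mat (C D)"
    using D by (auto simp: C_def diagonal_mat_def)
  show "diagonalisable (C A)"
    unfolding diagonalisable_def using dD CS by blast
  assume "eigenvalue (C A) z"
  then have "poly (char_poly (C D)) z = 0"
    using eigenvalue_root_char_poly[OF CA] char_poly_similar[OF CS] by simp
  moreover have "upper_triangular (C D)"
    using dD CD by (auto simp: diagonal_mat_def upper_triangular_def)
  ultimately have "(\<Prod>a\<leftarrow>diag_mat (C D). z - a) = 0"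
    by (simp add: char_poly_upper_triangular[OF CD] poly_prod_list o_def)
  then obtain k where "k < n" "z = C D $$ (k, k)"
    using CD by (auto simp: prod_list_zero_iff diag_mat_def)
  then show "z \<in> \<real>"
    using c by (auto simp: C_def)
qed

text \<open>\<open>None\<close> would contradict that \<open>A\<close> is a unit of the matrix ring;
  otherwise the computed left inverse equals the right inverse \<open>B\<close>.\<close>

lemma inv_mat_eqI:
  assumes A: "A \<in> carrier_mat n n" and B: "B \<in> carrier_mat n n"
    and AB: "A * B = 1\<^sub>m n" and BA: "B * A = 1\<^sub>m n"
  shows "inv_mat A = B"
proof (cases "mat_inverse A")
  case None
  have "A \<in> Units (ring_mat TYPE(real) n ())"
    using A B AB BA by (auto simp: Units_def ring_mat_def)
  with mat_inverse(1)[OF A None, where b = "()"] show ?thesis by simp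
next
  case (Some X)
  from mat_inverse(2)[OF A Some] have X: "X * A = 1\<^sub>m n" "X \<in> carrier_mat n n" by auto
  have "X = X * (A * B)" using X AB by simp
  also have "\<dots> = B" using X A B by (simp flip: assoc_mult_mat)
  finally show ?thesis using Some by (simp add: inv_mat_def)
qed

section \<open>Block matrices\<close>

lemma sum_lessThan_blocks:
  fixes f :: "nat \<Rightarrow> 'a :: comm_monoid_add"
  shows "(\<Sum>i = 0..<3 * n. f i) =
    (\<Sum>k = 0..<n. f k) + (\<Sum>k = 0..<n. f (n + k)) + (\<Sum>k = 0..<n. f (2 * n + k))"
proof -
  have "(\<Sum>i = a..<a + n. f i) = (\<Sum>k = 0..<n. f (a + k))" for a
    using sum.shift_bounds_nat_ivl[of f 0 a n] by (simp add: add.commute)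
  note shift = this
  have "n + n = 2 * n" "2 * n + n = 3 * n" by simp_all
  then have "(\<Sum>i = n..<2 * n. f i) = (\<Sum>k = 0..<n. f (n + k))"
    "(\<Sum>i = 2 * n..<3 * n. f i) = (\<Sum>k = 0..<n. f (2 * n + k))"
    using shift[of n] shift[of "2 * n"] by metis+
  then show ?thesis
    using sum.atLeastLessThan_concat[of 0 n "2 * n" f]
      sum.atLeastLessThan_concat[of 0 "2 * n" "3 * n" f] by simp
qed

lemma block3_mat_mult:
  assumes X: "\<And>a b. a < 3 \<Longrightarrow> b < 3 \<Longrightarrow> X ! a ! b \<in> carrier_mat n n"
    and Y: "\<And>a b. a < 3 \<Longrightarrow> b < 3 \<Longrightarrow> Y ! a ! b \<in> carrier_mat n n"
    and Z: "\<And>a b. a < 3 \<Longrightarrow> b < 3 \<Longrightarrow>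
      Z ! a ! b = X ! a ! 0 * Y ! 0 ! b + X ! a ! 1 * Y ! 1 ! b + X ! a ! 2 * Y ! 2 ! b"
  shows "block3_mat n X * block3_mat n Y = block3_mat n Z"
proof (rule eq_matI)
  fix i j assume "i < dim_row (block3_mat n Z)" "j < dim_col (block3_mat n Z)"
  then have ij: "i < 3 * n" "j < 3 * n" by (simp_all add: block3_mat_def)
  then have n: "n > 0" by (cases n) auto
  define a b where ab: "a = i div n" "b = j div n"
  have ab3: "a < 3" "b < 3"
    using ij n by (simp_all add: ab less_mult_imp_div_less)
  have m: "i mod n < n" "j mod n < n" using n by simp_all
  have entry: "(X ! a ! c * Y ! c ! b) $$ (i mod n, j mod n) =
      (\<Sum>k = 0..<n. X ! a ! c $$ (i mod n, k) * Y ! c ! b $$ (k, j mod n))" if "c < 3" for c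
    using X[OF ab3(1) that] Y[OF that ab3(2)] m by (simp add: scalar_prod_def)
  have car: "X ! a ! c * Y ! c ! b \<in> carrier_mat n n" if "c < 3" for c
    using X[OF ab3(1) that] Y[OF that ab3(2)] by simp
  have "(block3_mat n X * block3_mat n Y) $$ (i, j) = (\<Sum>k = 0..<3 * n.
      X ! a ! (k div n) $$ (i mod n, k mod n) * Y ! (k div n) ! b $$ (k mod n, j mod n))"
    using ij by (simp add: block3_mat_def scalar_prod_def ab)
  also have "\<dots> = (\<Sum>k = 0..<n. X ! a ! 0 $$ (i mod n, k) * Y ! 0 ! b $$ (k, j mod n))
      + (\<Sum>k = 0..<n. X ! a ! 1 $$ (i mod n, k) * Y ! 1 ! b $$ (k, j mod n))
      + (\<Sum>k = 0..<n. X ! a ! 2 $$ (i mod n, k) * Y ! 2 ! b $$ (k, j mod n))"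
    unfolding sum_lessThan_blocks using n by simp
  also have "\<dots> = Z ! a ! b $$ (i mod n, j mod n)"
    using car[of 0] car[of 1] car[of 2] m
    by (simp add: Z[OF ab3] entry del: index_mult_mat)
  also have "\<dots> = block3_mat n Z $$ (i, j)"
    using ij by (simp add: block3_mat_def ab)
  finally show "(block3_mat n X * block3_mat n Y) $$ (i, j) = block3_mat n Z $$ (i, j)" .
qed (simp_all add: block3_mat_def)

section \<open>Calculus of diagonal matrices between two fixed outer factors\<close>

lemma mat_diag_add: "mat_diag n f + mat_diag n g = mat_diag n (\<lambda>i. f i + g i :: 'a :: monoid_add)"
  by (auto simp: mat_diag_def)

text \<open>The outer factors may all differ, so that one rule covers conjugation by
  \<open>R\<close> as well as products in which one side is already in eigencoordinates and carries
  the identity.\<close>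

lemma sandwich_mult:
  fixes X Y Y' Z :: "'a :: comm_ring_1 mat"
  assumes "X \<in> carrier_mat n n" "Y \<in> carrier_mat n n" "Y' \<in> carrier_mat n n" "Z \<in> carrier_mat n n"
    and "Y * Y' = 1\<^sub>m n"
  shows "(X * mat_diag n f * Y) * (Y' * mat_diag n g * Z) = X * mat_diag n (\<lambda>i. f i * g i) * Z"
proof -
  have "(X * mat_diag n f * Y) * (Y' * mat_diag n g * Z) =
      X * (mat_diag n f * ((Y * Y') * (mat_diag n g * Z)))"
    using assms(1-4) by (simp add: assoc_mult_mat[of _ n n _ n _ n] mult_carrier_mat[of _ n n _ n] del: mat_diag_diag)
  also have "\<dots> = X * ((mat_diag n f * mat_diag n g) * Z)"
    using assms by (simp add: assoc_mult_mat[of _ n n _ n _ n] mult_carrier_mat[of _ n n _ n]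
        left_mult_one_mat[of _ n n] del: mat_diag_diag)
  also have "\<dots> = X * mat_diag n (\<lambda>i. f i * g i) * Z"
    using assms(1-4) by (simp add: assoc_mult_mat[of _ n n _ n _ n] mult_carrier_mat[of _ n n _ n])
  finally show ?thesis .
qed

lemma sandwich_add:
  fixes X Y :: "'a :: comm_ring_1 mat"
  assumes "X \<in> carrier_mat n n" "Y \<in> carrier_mat n n"
  shows "X * mat_diag n f * Y + X * mat_diag n g * Y = X * mat_diag n (\<lambda>i. f i + g i) * Y"
  using assms
  by (simp add: mult_add_distrib_mat[of _ n n _ n] add_mult_distrib_mat[of _ n n _ _ n]
      flip: mat_diag_add)

lemma sandwich_smult:
  fixes X Y :: "'a :: comm_ring_1 mat"
  assumes "X \<in> carrier_mat n n" "Y \<in> carrier_mat n n"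
  shows "c \<cdot>\<^sub>m (X * mat_diag n f * Y) = X * mat_diag n (\<lambda>i. c * f i) * Y"
proof -
  have "mat_diag n (\<lambda>i. c * f i) = c \<cdot>\<^sub>m mat_diag n f" by (auto simp: mat_diag_def)
  then show ?thesis
    using assms by (simp add: mult_smult_distrib[of _ n n _ n] mult_smult_assoc_mat[of _ n n _ n])
qed

lemma sandwich_minus:
  fixes X Y :: "'a :: comm_ring_1 mat"
  assumes "X \<in> carrier_mat n n" "Y \<in> carrier_mat n n"
  shows "X * mat_diag n f * Y - X * mat_diag n g * Y = X * mat_diag n (\<lambda>i. f i - g i) * Y"
    and "- (X * mat_diag n f * Y) = X * mat_diag n (\<lambda>i. - f i) * Y"
proof -
  have neg: "- M = (-1) \<cdot>\<^sub>m M" for M :: "'a mat" by auto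
  show N: "- (X * mat_diag n f * Y) = X * mat_diag n (\<lambda>i. - f i) * Y" for f
    unfolding neg sandwich_smult[OF assms] by simp
  have "X * mat_diag n f * Y - X * mat_diag n g * Y =
      X * mat_diag n f * Y + - (X * mat_diag n g * Y)"
    using assms by (intro minus_add_uminus_mat[of _ n n]) auto
  then show "X * mat_diag n f * Y - X * mat_diag n g * Y = X * mat_diag n (\<lambda>i. f i - g i) * Y"
    unfolding N sandwich_add[OF assms] by simp
qed

lemma sandwich_cong:
  assumes "\<And>i. i < n \<Longrightarrow> f i = g i"
  shows "X * mat_diag n f * Y = X * mat_diag n g * Y"
proof -
  have "mat_diag n f = mat_diag n g" using assms by (auto simp: mat_diag_def)
  then show ?thesis by simp
qed

text \<open>In \<open>F a b i\<close> the indices \<open>a\<close>, \<open>b\<close> select the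
  block and \<open>i\<close> the mode. Up to the outer factors and a reordering of indices this is
  the direct sum over \<open>i\<close> of the 3 x 3 matrices with entries
  \<open>F a b i\<close>.\<close>

definition sandwich3 ::
    "nat \<Rightarrow> real mat \<Rightarrow> real mat \<Rightarrow> (nat \<Rightarrow> nat \<Rightarrow> nat \<Rightarrow> real) \<Rightarrow> real mat" where
  "sandwich3 n X Y F = block3_mat n
     (map (\<lambda>a. map (\<lambda>b. X * mat_diag n (F a b) * Y) [0..<3]) [0..<3])"

lemma sandwich3_carrier [simp]: "sandwich3 n X Y F \<in> carrier_mat (3 * n) (3 * n)"
  by (simp add: sandwich3_def block3_mat_def)

lemma sandwich3_cong:
  assumes "\<And>a b i. a < 3 \<Longrightarrow> b < 3 \<Longrightarrow> i < n \<Longrightarrow> F a b i = G a b i"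
  shows "sandwich3 n X Y F = sandwich3 n X Y G"
  unfolding sandwich3_def using assms
  by (intro arg_cong[where f = "block3_mat n"] map_cong sandwich_cong) auto

text \<open>The inner factors cancel, and the modes do not interact: what remains is 3 x 3 matrix
  multiplication for each \<open>i\<close> separately.\<close>

lemma sandwich3_mult:
  assumes "X \<in> carrier_mat n n" "Y \<in> carrier_mat n n" "Y' \<in> carrier_mat n n" "Z \<in> carrier_mat n n"
    and "Y * Y' = 1\<^sub>m n"
  shows "sandwich3 n X Y F * sandwich3 n Y' Z G =
    sandwich3 n X Z (\<lambda>a b i. F a 0 i * G 0 b i + F a 1 i * G 1 b i + F a 2 i * G 2 b i)"
  unfolding sandwich3_def
proof (rule block3_mat_mult)
  fix a b :: nat assume "a < 3" "b < 3"
  then show "map (\<lambda>a. map (\<lambda>b. X * mat_diag n (\<lambda>i. F a 0 i * G 0 b i + F a 1 i * G 1 b i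
        + F a 2 i * G 2 b i) * Z) [0..<3]) [0..<3] ! a ! b =
      map (\<lambda>a. map (\<lambda>b. X * mat_diag n (F a b) * Y) [0..<3]) [0..<3] ! a ! 0
        * map (\<lambda>a. map (\<lambda>b. Y' * mat_diag n (G a b) * Z) [0..<3]) [0..<3] ! 0 ! b
      + map (\<lambda>a. map (\<lambda>b. X * mat_diag n (F a b) * Y) [0..<3]) [0..<3] ! a ! 1
        * map (\<lambda>a. map (\<lambda>b. Y' * mat_diag n (G a b) * Z) [0..<3]) [0..<3] ! 1 ! b
      + map (\<lambda>a. map (\<lambda>b. X * mat_diag n (F a b) * Y) [0..<3]) [0..<3] ! a ! 2
        * map (\<lambda>a. map (\<lambda>b. Y' * mat_diag n (G a b) * Z) [0..<3]) [0..<3] ! 2 ! b"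
    by (simp add: sandwich_mult[OF assms] sandwich_add[OF assms(1,4)] numeral_2_eq_2)
qed (use assms in auto)

lemma sandwich3_one:
  assumes "X \<in> carrier_mat n n" "Y \<in> carrier_mat n n" "X * Y = 1\<^sub>m n"
  shows "sandwich3 n X Y (\<lambda>a b i. if a = b then 1 else 0) = 1\<^sub>m (3 * n)"
proof -
  have zero: "X * mat_diag n (\<lambda>i. 0) * Y = 0\<^sub>m n n"
  proof -
    have "mat_diag n (\<lambda>i. 0) = (0\<^sub>m n n :: real mat)" by (auto simp: mat_diag_def)
    then show ?thesis using assms(1,2) by simp
  qed
  have one: "X * mat_diag n (\<lambda>i. 1) * Y = 1\<^sub>m n"
    using assms by simp
  have *: "map (\<lambda>a. map (\<lambda>b. X * mat_diag n (\<lambda>i. if a = b then 1 else 0) * Y) [0..<3]) [0..<3] ! a ! b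
      = (if a = b then 1\<^sub>m n else 0\<^sub>m n n)" if "a < 3" "b < 3" for a b
    using that by (simp add: zero one del: mat_diag_one)
  show ?thesis
  proof (rule eq_matI)
    fix i j assume "i < dim_row (1\<^sub>m (3 * n))" "j < dim_col (1\<^sub>m (3 * n) :: real mat)"
    then have ij: "i < 3 * n" "j < 3 * n" by simp_all
    then have n: "n > 0" by (cases n) auto
    have d: "i div n < 3" "j div n < 3"
      using ij n by (simp_all add: less_mult_imp_div_less)
    have "i = j \<longleftrightarrow> i div n = j div n \<and> i mod n = j mod n"
      by (metis div_mult_mod_eq)
    then show "sandwich3 n X Y (\<lambda>a b i. if a = b then 1 else 0) $$ (i, j) = 1\<^sub>m (3 * n) $$ (i, j)"
      using ij n by (auto simp: sandwich3_def block3_mat_def *[OF d])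
  qed (simp_all add: sandwich3_def block3_mat_def)
qed

section \<open>The blockwise spectral decomposition\<close>

text \<open>For fixed \<open>i\<close>, \<open>F\<close> is the deterministic system matrix. Since
  \<open>c i > 0\<close>, its eigenvector matrix \<open>V\<close> has an inverse given by rational
  formulas.\<close>

lemma swlme_block_similar_diagonal:
  fixes R R' :: "real mat" and h u v :: "nat \<Rightarrow> real"
  assumes R: "R \<in> carrier_mat n n" "R' \<in> carrier_mat n n" "R * R' = 1\<^sub>m n" "R' * R = 1\<^sub>m n"
    and h: "\<And>i. i < n \<Longrightarrow> h i > 0" and g: "g > 0"
  defines "F \<equiv> (\<lambda>a b i. [[0, 1, 0],
    [g * h i - (u i)\<^sup>2 - (v i)\<^sup>2 / 3, 2 * u i, 2 / 3 * v i],
    [- 2 * u i * v i, 2 * v i, u i]] ! a ! b)"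
  shows "\<exists>D. diagonal_mat D \<and> similar_mat (sandwich3 n R R' F) D"
proof -
  define c where "c i = sqrt (g * h i + (v i)\<^sup>2)" for i
  have c: "c i > 0" "(c i)\<^sup>2 = g * h i + (v i)\<^sup>2" if "i < n" for i
  proof -
    have "g * h i + (v i)\<^sup>2 > 0" using h[OF that] g by (simp add: add_pos_nonneg)
    then show "c i > 0" "(c i)\<^sup>2 = g * h i + (v i)\<^sup>2" by (simp_all add: c_def)
  qed
  define L :: "nat \<Rightarrow> nat \<Rightarrow> nat \<Rightarrow> real" where
    "L a b i = (if a = b then [u i, u i + c i, u i - c i] ! a else 0)" for a b i
  \<comment> \<open>The columns are eigenvectors, in the order of the eigenvalues listed in
    \<open>L\<close>.\<close>
  define V :: "nat \<Rightarrow> nat \<Rightarrow> nat \<Rightarrow> real" where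
    "V a b i = [[2 * v i, 1, 1],
      [2 * u i * v i, u i + c i, u i - c i],
      [(v i)\<^sup>2 - 3 * (g * h i), 2 * v i, 2 * v i]] ! a ! b" for a b i
  \<comment> \<open>The inverse of \<open>V\<close>, simplified with g h + v^2 = c^2.\<close>
  define W :: "nat \<Rightarrow> nat \<Rightarrow> nat \<Rightarrow> real" where
    "W a b i = [[2 * v i / (3 * (c i)\<^sup>2), 0, - 1 / (3 * (c i)\<^sup>2)],
      [(1 - 4 * (v i)\<^sup>2 / (3 * (c i)\<^sup>2) - u i / c i) / 2, 1 / (2 * c i), v i / (3 * (c i)\<^sup>2)],
      [(1 - 4 * (v i)\<^sup>2 / (3 * (c i)\<^sup>2) + u i / c i) / 2, - 1 / (2 * c i), v i / (3 * (c i)\<^sup>2)]] ! a ! b"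
    for a b i
  \<comment> \<open>For the inverse identities \<open>h\<close> is eliminated in favour of
    \<open>c\<close>, leaving denominators that are powers of the positive number
    \<open>c i\<close>.\<close>
  have gh: "g * h i = (c i)\<^sup>2 - (v i)\<^sup>2" if "i < n" for i using c(2)[OF that] by simp
  have lt3: "a < 3 \<longleftrightarrow> a = 0 \<or> a = 1 \<or> a = 2" for a :: nat by auto
  have VW: "V a 0 i * W 0 b i + V a 1 i * W 1 b i + V a 2 i * W 2 b i = (if a = b then 1 else 0)"
    if "a < 3" "b < 3" "i < n" for a b i
    using that(1,2) c(1)[OF that(3)] unfolding lt3
    by (auto simp: V_def W_def gh[OF that(3)] field_simps power2_eq_square)
  have WV: "W a 0 i * V 0 b i + W a 1 i * V 1 b i + W a 2 i * V 2 b i = (if a = b then 1 else 0)"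
    if "a < 3" "b < 3" "i < n" for a b i
    using that(1,2) c(1)[OF that(3)] unfolding lt3
    by (auto simp: V_def W_def gh[OF that(3)] field_simps power2_eq_square)
  \<comment> \<open>For the eigenvector identity the elimination goes the other way. The second form
    catches squares of \<open>c i\<close> inside right-nested products.\<close>
  have cc: "c i * c i = g * h i + v i * v i" "c i * (c i * x) = (g * h i + v i * v i) * x"
    if "i < n" for i x
  proof -
    show "c i * c i = g * h i + v i * v i"
      using c(2)[OF that] unfolding power2_eq_square .
    then show "c i * (c i * x) = (g * h i + v i * v i) * x"
      by (metis mult.assoc)
  qed
  have FV: "F a 0 i * V 0 b i + F a 1 i * V 1 b i + F a 2 i * V 2 b i
      = V a 0 i * L 0 b i + V a 1 i * L 1 b i + V a 2 i * L 2 b i"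
    if "a < 3" "b < 3" "i < n" for a b i
    using that(1,2) unfolding lt3
    by (auto simp: V_def F_def L_def cc[OF that(3)] algebra_simps power2_eq_square)
  let ?I = "1\<^sub>m n :: real mat"
  have I: "?I \<in> carrier_mat n n" "?I * ?I = ?I" by simp_all
  \<comment> \<open>\<open>R\<close> maps eigencoordinates to the original ones, so it stands on the
    left of \<open>P\<close> and \<open>R'\<close> on the right of \<open>Q\<close>.
    \<open>D\<close> carries identities on both sides and is therefore literally diagonal, not
    merely conjugate to a diagonal matrix.\<close>
  define A P D Q where "A = sandwich3 n R R' F" "P = sandwich3 n R ?I V"
    and "D = sandwich3 n ?I ?I L" "Q = sandwich3 n ?I R' W"
  note defs = this
  have PQ: "P * Q = 1\<^sub>m (3 * n)"
    unfolding defs sandwich3_mult[OF R(1) I(1) I(1) R(2) I(2)] sandwich3_one[OF R(1-3), symmetric]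
    by (rule sandwich3_cong) (rule VW)
  have QP: "Q * P = 1\<^sub>m (3 * n)"
    unfolding defs sandwich3_mult[OF I(1) R(2) R(1) I(1) R(4)] sandwich3_one[OF I(1) I(1) I(2), symmetric]
    by (rule sandwich3_cong) (rule WV)
  have AP: "A * P = P * D"
    unfolding defs sandwich3_mult[OF R(1) R(2) R(1) I(1) R(4)] sandwich3_mult[OF R(1) I(1) I(1) I(1) I(2)]
    by (rule sandwich3_cong) (rule FV)
  have car: "A \<in> carrier_mat (3 * n) (3 * n)" "P \<in> carrier_mat (3 * n) (3 * n)"
    "D \<in> carrier_mat (3 * n) (3 * n)" "Q \<in> carrier_mat (3 * n) (3 * n)"
    by (simp_all add: defs)
  have "A = A * (P * Q)" using PQ car by simp
  also have "\<dots> = P * D * Q" using car by (simp add: AP flip: assoc_mult_mat)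
  finally have "similar_mat A D"
    using car PQ QP by (intro similar_matI[of _ _ P Q "3 * n"]) auto
  moreover have "diagonal_mat D"
    unfolding diagonal_mat_def
  proof (intro allI impI)
    fix i j assume "i < dim_row D" "j < dim_col D" and ne: "i \<noteq> j"
    then have ij: "i < 3 * n" "j < 3 * n" using car by auto
    then have n: "n > 0" by (cases n) auto
    have d: "i div n < 3" "j div n < 3"
      using ij n by (simp_all add: less_mult_imp_div_less)
    have "i div n \<noteq> j div n \<or> i mod n \<noteq> j mod n"
      using ne by (metis div_mult_mod_eq)
    then show "D $$ (i, j) = 0"
      using ij n d by (auto simp: defs sandwich3_def block3_mat_def mat_diag_def L_def)
  qed
  ultimately show ?thesis unfolding defs by blast
qed

text \<open>\<Phi> turns pointwise operations on functions of the mode into matrix operations, so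
  each block is \<Phi> of the corresponding entry of the deterministic matrix.\<close>

lemma commuting_blocks_similar_diagonal:
  fixes R R' :: "real mat" and h u v :: "nat \<Rightarrow> real"
  assumes R: "R \<in> carrier_mat n n" "R' \<in> carrier_mat n n" "R * R' = 1\<^sub>m n" "R' * R = 1\<^sub>m n"
    and h: "\<And>i. i < n \<Longrightarrow> h i > 0" and g: "g > 0"
  defines "\<Phi> \<equiv> \<lambda>f. R * mat_diag n f * R'"
  assumes H: "H = \<Phi> h" and H': "H' = \<Phi> (\<lambda>i. 1 / h i)"
    and U0: "U0 = \<Phi> u" and U1: "U1 = \<Phi> v"
    and Q0: "Q0 = \<Phi> (\<lambda>i. h i * u i)" and Q1: "Q1 = \<Phi> (\<lambda>i. h i * v i)"
  shows "\<exists>D. diagonal_mat D \<and> similar_mat (block3_mat n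
       [[0\<^sub>m n n, 1\<^sub>m n, 0\<^sub>m n n],
        [g \<cdot>\<^sub>m H - Q0 * H' * U0 - (1/3) \<cdot>\<^sub>m (Q1 * H' * U1), Q0 * H' + U0, (1/3) \<cdot>\<^sub>m (Q1 * H' + U1)],
        [- (Q0 * H' * U1) - Q1 * H' * U0, Q1 * H' + U1, Q0 * H']]) D"
proof -
  have \<Phi>_app: "R * mat_diag n f * R' = \<Phi> f" for f by (simp add: \<Phi>_def)
  have \<Phi>_mult: "\<Phi> f * \<Phi> k = \<Phi> (\<lambda>i. f i * k i)" for f k
    unfolding \<Phi>_def by (rule sandwich_mult[OF R(1,2,1,2,4)])
  have \<Phi>_add: "\<Phi> f + \<Phi> k = \<Phi> (\<lambda>i. f i + k i)" for f k
    unfolding \<Phi>_def by (rule sandwich_add[OF R(1,2)])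
  have \<Phi>_minus: "\<Phi> f - \<Phi> k = \<Phi> (\<lambda>i. f i - k i)" "- \<Phi> f = \<Phi> (\<lambda>i. - f i)" for f k
    unfolding \<Phi>_def by (rule sandwich_minus[OF R(1,2)])+
  have \<Phi>_smult: "a \<cdot>\<^sub>m \<Phi> f = \<Phi> (\<lambda>i. a * f i)" for a f
    unfolding \<Phi>_def by (rule sandwich_smult[OF R(1,2)])
  have \<Phi>_cong: "(\<And>i. i < n \<Longrightarrow> f i = k i) \<Longrightarrow> \<Phi> f = \<Phi> k" for f k
    unfolding \<Phi>_def by (rule sandwich_cong)
  have one: "\<Phi> (\<lambda>i. 1) = 1\<^sub>m n" using R by (simp add: \<Phi>_def)
  have "\<Phi> (\<lambda>i. 0) = 0 \<cdot>\<^sub>m \<Phi> (\<lambda>i. 0)" by (simp add: \<Phi>_smult)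
  also have "\<dots> = 0\<^sub>m n n" using R by (auto simp: \<Phi>_def)
  finally have zero: "\<Phi> (\<lambda>i. 0) = 0\<^sub>m n n" .
  have h0: "h i \<noteq> 0" if "i < n" for i using h[OF that] by simp
  have QH: "Q0 * H' = \<Phi> u" "Q1 * H' = \<Phi> v"
    unfolding Q0 Q1 H' \<Phi>_mult by (auto intro!: \<Phi>_cong simp: h0)
  let ?F = "\<lambda>a b i. [[0, 1, 0],
    [g * h i - (u i)\<^sup>2 - (v i)\<^sup>2 / 3, 2 * u i, 2 / 3 * v i],
    [- 2 * u i * v i, 2 * v i, u i]] ! a ! b"
  have upt: "[0..<3] = [0, 1, 2 :: nat]" by (simp add: upt_rec)
  \<comment> \<open>The zero and identity blocks are also rewritten as values of \<Phi>; both sides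
    are then nested lists of such values and are compared entry by entry.\<close>
  have F_eq: "block3_mat n
       [[0\<^sub>m n n, 1\<^sub>m n, 0\<^sub>m n n],
        [g \<cdot>\<^sub>m H - Q0 * H' * U0 - (1/3) \<cdot>\<^sub>m (Q1 * H' * U1), Q0 * H' + U0, (1/3) \<cdot>\<^sub>m (Q1 * H' + U1)],
        [- (Q0 * H' * U1) - Q1 * H' * U0, Q1 * H' + U1, Q0 * H']] = sandwich3 n R R' ?F"
    unfolding sandwich3_def QH H U0 U1 \<Phi>_mult \<Phi>_add \<Phi>_minus \<Phi>_smult \<Phi>_app upt
      list.map one[symmetric] zero[symmetric]
    by (intro arg_cong[where f = "block3_mat n"] arg_cong2[where f = Cons] refl \<Phi>_cong)
      (simp_all add: power2_eq_square algebra_simps)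
  show ?thesis
    unfolding F_eq using R h g by (rule swlme_block_similar_diagonal)
qed

section \<open>Galerkin matrices of the polynomial chaos basis\<close>

text \<open>\<open>f0\<close> and \<open>f1\<close> are the eigenvalues of \<open>Q0\<close> and
  \<open>Q1\<close>. The second equation in each of \<open>q0\<close> and \<open>q1\<close> is the
  compatibility P(H^-1 q) = H^-1 P(q), which a common eigenbasis of \<open>H\<close>,
  \<open>Q0\<close> and \<open>Q1\<close> does not supply by itself.\<close>

lemma sgswlme_matrix_similar_diagonal:
  fixes R R' :: "real mat" and M \<xi> \<psi>
  assumes n: "n = K + 1"
    and R: "R \<in> carrier_mat n n" "R' \<in> carrier_mat n n" "R * R' = 1\<^sub>m n" "R' * R = 1\<^sub>m n"
  defines "\<Phi> \<equiv> \<lambda>f. R * mat_diag n f * R'" and "P \<equiv> galerkin_matrix M \<xi> \<psi> K"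
  assumes h: "P (component K 0 W) = \<Phi> h" "\<And>i. i < n \<Longrightarrow> h i > 0" and g: "g > 0"
    and q0: "P (component K 1 W) = \<Phi> f0"
      "P (\<Phi> (\<lambda>i. 1 / h i) *\<^sub>v component K 1 W) = \<Phi> (\<lambda>i. f0 i / h i)"
    and q1: "P (component K 2 W) = \<Phi> f1"
      "P (\<Phi> (\<lambda>i. 1 / h i) *\<^sub>v component K 2 W) = \<Phi> (\<lambda>i. f1 i / h i)"
  shows "\<exists>D. diagonal_mat D \<and> similar_mat (sgswlme_matrix M \<xi> \<psi> g K W) D"
proof -
  have h0: "h i \<noteq> 0" if "i < n" for i using h(2)[OF that] by simp
  have \<Phi>_app: "R * mat_diag n f * R' = \<Phi> f" for f by (simp add: \<Phi>_def)
  have \<Phi>_cong: "(\<And>i. i < n \<Longrightarrow> f i = k i) \<Longrightarrow> \<Phi> f = \<Phi> k" for f k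
    unfolding \<Phi>_def by (rule sandwich_cong)
  have \<Phi>_mult: "\<Phi> f * \<Phi> k = \<Phi> (\<lambda>i. f i * k i)" for f k
    unfolding \<Phi>_def by (rule sandwich_mult[OF R(1,2,1,2,4)])
  have one: "\<Phi> (\<lambda>i. 1) = 1\<^sub>m n" using R by (simp add: \<Phi>_def)
  have car: "\<Phi> f \<in> carrier_mat n n" for f
    using R by (simp add: \<Phi>_def mult_carrier_mat[of _ n n _ n])
  have "\<Phi> h * \<Phi> (\<lambda>i. 1 / h i) = 1\<^sub>m n" "\<Phi> (\<lambda>i. 1 / h i) * \<Phi> h = 1\<^sub>m n"
    unfolding \<Phi>_mult one[symmetric] by (auto intro!: \<Phi>_cong simp: h0)
  then have inv: "inv_mat (\<Phi> h) = \<Phi> (\<lambda>i. 1 / h i)"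
    by (rule inv_mat_eqI[OF car car])
  show ?thesis
    unfolding sgswlme_matrix_def Let_def P_def[symmetric] h(1) inv n[symmetric]
  proof (rule commuting_blocks_similar_diagonal[OF R h(2) g, where u = "\<lambda>i. f0 i / h i"
        and v = "\<lambda>i. f1 i / h i", unfolded \<Phi>_app])
    show "P (component K 1 W) = \<Phi> (\<lambda>i. h i * (f0 i / h i))"
      unfolding q0 by (rule \<Phi>_cong) (simp add: h0)
    show "P (component K 2 W) = \<Phi> (\<lambda>i. h i * (f1 i / h i))"
      unfolding q1 by (rule \<Phi>_cong) (simp add: h0)
  qed (simp_all add: q0 q1 del: One_nat_def)
qed

text \<open>A polynomial of degree 0 is a constant \<open>s\<close>, and its normalisation gives s^2
  = 1; the sign stays open. With \<open>s\<close> pulled out of the integral, orthonormality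
  remains.\<close>

lemma orthonormal_polys_triple:
  assumes "prob_space M" and "orthonormal_polys M \<xi> \<psi>"
  obtains s where "s * s = 1"
    and "\<And>l m. (\<integral>\<omega>. poly (\<psi> 0) (\<xi> \<omega>) * poly (\<psi> l) (\<xi> \<omega>) * poly (\<psi> m) (\<xi> \<omega>) \<partial>M)
      = (if l = m then s else 0)"
    and "\<And>k m. (\<integral>\<omega>. poly (\<psi> k) (\<xi> \<omega>) * poly (\<psi> 0) (\<xi> \<omega>) * poly (\<psi> m) (\<xi> \<omega>) \<partial>M)
      = (if k = m then s else 0)"
    and "\<And>k l. (\<integral>\<omega>. poly (\<psi> k) (\<xi> \<omega>) * poly (\<psi> l) (\<xi> \<omega>) * poly (\<psi> 0) (\<xi> \<omega>) \<partial>M)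
      = (if k = l then s else 0)"
proof -
  interpret prob_space M by fact
  have deg: "Polynomial.degree (\<psi> 0) = 0"
    and orth: "(\<integral>\<omega>. poly (\<psi> k) (\<xi> \<omega>) * poly (\<psi> l) (\<xi> \<omega>) \<partial>M) = (if k = l then 1 else 0)" for k l
    using assms(2) by (auto simp: orthonormal_polys_def)
  from deg obtain s where s: "\<psi> 0 = [:s:]" by (rule degree_eq_zeroE)
  have "s * s = 1" using orth[of 0 0] by (simp add: s prob_space)
  moreover have "(\<integral>\<omega>. s * poly (\<psi> l) (\<xi> \<omega>) * poly (\<psi> m) (\<xi> \<omega>) \<partial>M) = (if l = m then s else 0)"
    "(\<integral>\<omega>. poly (\<psi> l) (\<xi> \<omega>) * s * poly (\<psi> m) (\<xi> \<omega>) \<partial>M) = (if l = m then s else 0)"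
    "(\<integral>\<omega>. poly (\<psi> l) (\<xi> \<omega>) * poly (\<psi> m) (\<xi> \<omega>) * s \<partial>M) = (if l = m then s else 0)" for l m
  proof -
    \<comment> \<open>Pulling out a real constant is valid for every Bochner integral, a
      nonintegrable function having integral 0.\<close>
    have "(\<integral>\<omega>. s * (poly (\<psi> l) (\<xi> \<omega>) * poly (\<psi> m) (\<xi> \<omega>)) \<partial>M) = (if l = m then s else 0)"
      by (simp add: orth)
    then show "(\<integral>\<omega>. s * poly (\<psi> l) (\<xi> \<omega>) * poly (\<psi> m) (\<xi> \<omega>) \<partial>M) = (if l = m then s else 0)"
      "(\<integral>\<omega>. poly (\<psi> l) (\<xi> \<omega>) * s * poly (\<psi> m) (\<xi> \<omega>) \<partial>M) = (if l = m then s else 0)"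
      "(\<integral>\<omega>. poly (\<psi> l) (\<xi> \<omega>) * poly (\<psi> m) (\<xi> \<omega>) * s \<partial>M) = (if l = m then s else 0)"
      by (simp_all only: ac_simps)
  qed
  ultimately show thesis
    using that[of s] by (simp add: s)
qed

text \<open>The corner formula holds with arbitrary higher modes: orthonormality gives <\<psi>_k
  \<psi>_0 \<psi>_0> = 0 for k > 0. It carries positivity of the height over to the truncated
  state.\<close>

lemma galerkin_matrix_constant:
  assumes "prob_space M" and "orthonormal_polys M \<xi> \<psi>"
  obtains s where "s * s = 1"
    and "\<And>K \<eta>. galerkin_matrix M \<xi> \<psi> K \<eta> $$ (0, 0) = s * \<eta> $ 0"
    and "\<And>K \<eta>. \<forall>k. 0 < k \<and> k \<le> K \<longrightarrow> \<eta> $ k = 0 \<Longrightarrow>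
      galerkin_matrix M \<xi> \<psi> K \<eta> = mat_diag (K + 1) (\<lambda>i. s * \<eta> $ 0)"
proof -
  obtain s where s: "s * s = 1"
    and triple:
      "\<And>l m. (\<integral>\<omega>. poly (\<psi> 0) (\<xi> \<omega>) * poly (\<psi> l) (\<xi> \<omega>) * poly (\<psi> m) (\<xi> \<omega>) \<partial>M)
        = (if l = m then s else 0)"
      "\<And>k m. (\<integral>\<omega>. poly (\<psi> k) (\<xi> \<omega>) * poly (\<psi> 0) (\<xi> \<omega>) * poly (\<psi> m) (\<xi> \<omega>) \<partial>M)
        = (if k = m then s else 0)"
      "\<And>k l. (\<integral>\<omega>. poly (\<psi> k) (\<xi> \<omega>) * poly (\<psi> l) (\<xi> \<omega>) * poly (\<psi> 0) (\<xi> \<omega>) \<partial>M)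
        = (if k = l then s else 0)"
    by (rule orthonormal_polys_triple[OF assms], rule that)
  have "galerkin_matrix M \<xi> \<psi> K \<eta> $$ (0, 0) = s * \<eta> $ 0" for K \<eta>
    by (simp add: galerkin_matrix_def triple_matrix_def triple if_distrib cong: if_cong)
  moreover have "galerkin_matrix M \<xi> \<psi> K \<eta> = mat_diag (K + 1) (\<lambda>i. s * \<eta> $ 0)"
    if z: "\<forall>k. 0 < k \<and> k \<le> K \<longrightarrow> \<eta> $ k = 0" for K \<eta>
  proof (rule eq_matI)
    fix l m assume "l < dim_row (mat_diag (K + 1) (\<lambda>i. s * \<eta> $ 0))"
      "m < dim_col (mat_diag (K + 1) (\<lambda>i. s * \<eta> $ 0))"
    then have lm: "l < K + 1" "m < K + 1" by (simp_all add: mat_diag_def)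
    have "galerkin_matrix M \<xi> \<psi> K \<eta> $$ (l, m)
        = (\<Sum>k\<le>K. \<eta> $ k * triple_matrix M \<xi> \<psi> K k $$ (l, m))"
      using lm by (simp add: galerkin_matrix_def)
    also have "\<dots> = (\<Sum>k\<le>K. if k = 0 then \<eta> $ 0 * triple_matrix M \<xi> \<psi> K 0 $$ (l, m) else 0)"
      using z by (intro sum.cong) auto
    also have "\<dots> = mat_diag (K + 1) (\<lambda>i. s * \<eta> $ 0) $$ (l, m)"
      using lm by (simp add: triple_matrix_def triple mat_diag_def)
    finally show "galerkin_matrix M \<xi> \<psi> K \<eta> $$ (l, m) = mat_diag (K + 1) (\<lambda>i. s * \<eta> $ 0) $$ (l, m)" .
  qed (simp_all add: galerkin_matrix_def mat_diag_def)
  ultimately show thesis using that[OF s] by blast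
qed

lemma positive_definite_corner:
  assumes "positive_definite A" and "A \<in> carrier_mat n n" and "n > 0"
  shows "A $$ (0, 0) > 0"
proof -
  have "unit_vec n 0 \<bullet> (A *\<^sub>v unit_vec n 0) > 0"
    using assms unit_vec_nonzero[of 0 n] unfolding positive_definite_def
    by (metis carrier_matD(1) unit_vec_carrier)
  moreover have "unit_vec n 0 \<bullet> (A *\<^sub>v unit_vec n 0) = (A *\<^sub>v unit_vec n 0) $ 0"
    using assms(2,3) by (intro scalar_prod_left_unit[of _ n]) auto
  ultimately show ?thesis
    using assms(2,3) by simp
qed

text \<open>
  Without higher modes every block is a multiple of the identity. The hypothesis on the water height
  is inherited from the untruncated state \<open>W\<close>, whose Galerkin matrix has the same corner entry.
\<close>

lemma sgswlme_matrix_constant_similar_diagonal: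
  assumes M: "prob_space M" "orthonormal_polys M \<xi> \<psi>" and g: "g > 0"
    and W: "W \<in> sgswlme_states M \<xi> \<psi> K"
    and W'0: "W' $ 0 = W $ 0"
    and W': "\<And>i k. i < 3 \<Longrightarrow> 0 < k \<Longrightarrow> k \<le> K \<Longrightarrow> W' $ (i * (K + 1) + k) = 0"
  shows "\<exists>D. diagonal_mat D \<and> similar_mat (sgswlme_matrix M \<xi> \<psi> g K W') D"
proof -
  obtain s where s: "s * s = 1"
    and corner: "\<And>K \<eta>. galerkin_matrix M \<xi> \<psi> K \<eta> $$ (0, 0) = s * \<eta> $ 0"
    and const: "\<And>K \<eta>. \<forall>k. 0 < k \<and> k \<le> K \<longrightarrow> \<eta> $ k = 0 \<Longrightarrow>
      galerkin_matrix M \<xi> \<psi> K \<eta> = mat_diag (K + 1) (\<lambda>i. s * \<eta> $ 0)"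
    by (rule galerkin_matrix_constant[OF M], rule that)
  let ?n = "K + 1" and ?I = "1\<^sub>m (K + 1) :: real mat"
  have "galerkin_matrix M \<xi> \<psi> K (component K 0 W) $$ (0, 0) > 0"
    using W by (intro positive_definite_corner[of _ ?n])
      (auto simp: sgswlme_states_def Let_def galerkin_matrix_def)
  then have pos: "s * W' $ 0 > 0" by (simp add: corner component_def W'0)
  have low: "component K i W' $ k = 0" if "i < 3" "0 < k" "k \<le> K" for i k
    using W'[OF that] that by (simp add: component_def)
  have I: "?I * mat_diag ?n f * ?I = mat_diag ?n f" for f
    by (simp only: right_mult_one_mat[OF mat_diag_dim] left_mult_one_mat[OF mat_diag_dim])
  define c where "c = s * W' $ 0"
  have c: "c > 0" using pos by (simp add: c_def)
  have P: "galerkin_matrix M \<xi> \<psi> K (component K i W') =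
      mat_diag ?n (\<lambda>j. s * component K i W' $ 0)" if "i < 3" for i
    using low[OF that] by (intro const) simp
  \<comment> \<open>The inverse of \<open>H\<close> is division by \<open>c\<close>, so the velocity
    vector has no higher modes either and its Galerkin matrix is again scalar.\<close>
  have U: "galerkin_matrix M \<xi> \<psi> K (mat_diag ?n (\<lambda>j. 1 / c) *\<^sub>v component K i W') =
      mat_diag ?n (\<lambda>j. s * component K i W' $ 0 / c)" if "i < 3" for i
  proof -
    define w where "w = mat_diag ?n (\<lambda>j. 1 / c) *\<^sub>v component K i W'"
    have w_idx: "w $ k = component K i W' $ k / c" if "k \<le> K" for k
      using that by (simp add: w_def mat_diag_def scalar_prod_def component_def mult_delta_left)
    have "galerkin_matrix M \<xi> \<psi> K w = mat_diag ?n (\<lambda>j. s * w $ 0)"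
      by (rule const) (simp add: w_idx low[OF that])
    then show ?thesis by (simp add: w_idx w_def[symmetric] del: One_nat_def)
  qed
  show ?thesis
  proof (rule sgswlme_matrix_similar_diagonal[where R = ?I and R' = ?I and h = "\<lambda>j. c"
        and ?f0.0 = "\<lambda>j. s * component K 1 W' $ 0" and ?f1.0 = "\<lambda>j. s * component K 2 W' $ 0"])
    show "galerkin_matrix M \<xi> \<psi> K (component K 0 W') = ?I * mat_diag ?n (\<lambda>j. c) * ?I"
      unfolding I P[OF zero_less_numeral] c_def by (simp add: component_def)
  qed (simp_all only: I, simp_all add: P U c g del: One_nat_def)
qed

text \<open>
  The Galerkin matrices of order one all lie in the commutative algebra generated by the symmetric
  matrix \<open>\<M>\<^sub>1\<close>. With \<open>s = \<plusminus>1\<close> the value of \<open>\<psi>\<^sub>0\<close> and \<open>t = \<langle>\<psi>\<^sub>1\<^sup>3\<rangle>\<close>, its eigenvalues \<open>a\<close> and \<open>b\<close> are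
  the roots of \<open>x\<^sup>2 - t x - 1\<close>, with eigenvectors \<open>(s, a)\<close> and \<open>(s, b)\<close>.
\<close>

lemma sgswlme_matrix_order_one_similar_diagonal:
  assumes M: "prob_space M" "orthonormal_polys M \<xi> \<psi>" and g: "g > 0"
    and W: "W \<in> sgswlme_states M \<xi> \<psi> 1"
  shows "\<exists>D. diagonal_mat D \<and> similar_mat (sgswlme_matrix M \<xi> \<psi> g 1 W) D"
proof -
  obtain s where s: "s * s = 1"
    and triple:
      "\<And>l m. (\<integral>\<omega>. poly (\<psi> 0) (\<xi> \<omega>) * poly (\<psi> l) (\<xi> \<omega>) * poly (\<psi> m) (\<xi> \<omega>) \<partial>M)
        = (if l = m then s else 0)"
      "\<And>k m. (\<integral>\<omega>. poly (\<psi> k) (\<xi> \<omega>) * poly (\<psi> 0) (\<xi> \<omega>) * poly (\<psi> m) (\<xi> \<omega>) \<partial>M)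
        = (if k = m then s else 0)"
      "\<And>k l. (\<integral>\<omega>. poly (\<psi> k) (\<xi> \<omega>) * poly (\<psi> l) (\<xi> \<omega>) * poly (\<psi> 0) (\<xi> \<omega>) \<partial>M)
        = (if k = l then s else 0)"
    by (rule orthonormal_polys_triple[OF M], rule that)
  \<comment> \<open>Every other triple product of order one contains the index 0, so
    \<open>t\<close> is the only moment of the distribution that enters.\<close>
  define t where "t = (\<integral>\<omega>. poly (\<psi> 1) (\<xi> \<omega>) * poly (\<psi> 1) (\<xi> \<omega>) * poly (\<psi> 1) (\<xi> \<omega>) \<partial>M)"
  define r where "r = sqrt (t\<^sup>2 + 4)"
  define a where "a = (t + r) / 2"
  define b where "b = (t - r) / 2"
  \<comment> \<open>The reciprocal of a - b; the positive discriminant t^2 + 4 makes the two roots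
    distinct.\<close>
  define \<rho> where "\<rho> = 1 / r"
  have "t\<^sup>2 + 4 > 0" by (simp add: add_nonneg_pos)
  then have r: "r > 0" "r * r = t * t + 4"
    by (simp_all add: r_def power2_eq_square)
  have ab: "a * b = -1" "t = a + b" "\<rho> * (a - b) = 1"
    using r by (simp_all add: a_def b_def \<rho>_def field_simps)
  have P: "galerkin_matrix M \<xi> \<psi> 1 \<eta> = Matrix.mat 2 2 (\<lambda>(i, j).
      [[s * \<eta> $ 0, s * \<eta> $ 1], [s * \<eta> $ 1, s * \<eta> $ 0 + t * \<eta> $ 1]] ! i ! j)" for \<eta>
    by (rule eq_matI)
      (auto simp: galerkin_matrix_def triple_matrix_def triple t_def less_Suc_eq numeral_2_eq_2)
  define R where "R = Matrix.mat 2 2 (\<lambda>(i, j). [[s, s], [a, b]] ! i ! j)"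
  \<comment> \<open>Cramer's rule for \<open>R\<close>, whose determinant is s (b - a), with 1/s =
    s.\<close>
  define R' where "R' = Matrix.mat 2 2 (\<lambda>(i, j). [[- s * b * \<rho>, \<rho>], [s * a * \<rho>, - \<rho>]] ! i ! j)"
  have R: "R \<in> carrier_mat 2 2" "R' \<in> carrier_mat 2 2"
    by (simp_all add: R_def R'_def)
  have lt2: "i < 2 \<longleftrightarrow> i = 0 \<or> i = 1" for i :: nat by auto
  have sum2: "(\<Sum>i = 0..<2. f i) = f 0 + f 1" for f :: "nat \<Rightarrow> real"
    by (simp add: numeral_2_eq_2)
  have RR': "R * R' = 1\<^sub>m 2"
  proof (rule eq_matI)
    fix i j assume "i < dim_row (1\<^sub>m 2 :: real mat)" "j < dim_col (1\<^sub>m 2 :: real mat)"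
    then have "i = 0 \<or> i = 1" "j = 0 \<or> j = 1" by auto
    moreover have "s * (- s * b * \<rho>) + s * (s * a * \<rho>) = 1"
      using s ab(3) by Groebner_Basis.algebra
    moreover have "a * (- s * b * \<rho>) + b * (s * a * \<rho>) = 0" "a * \<rho> - b * \<rho> = 1"
      using ab(3) by (simp_all add: algebra_simps)
    ultimately show "(R * R') $$ (i, j) = 1\<^sub>m 2 $$ (i, j)"
      by (auto simp: R_def R'_def scalar_prod_def sum2)
  qed (simp_all add: R_def R'_def)
  have R'R: "R' * R = 1\<^sub>m 2"
    using mat_mult_left_right_inverse[OF R RR'] .
  define \<Phi> where "\<Phi> f = R * mat_diag 2 f * R'" for f
  have \<Phi>: "\<Phi> f = Matrix.mat 2 2 (\<lambda>(i, j).
      [[(a * f 1 - b * f 0) * \<rho>, s * (f 0 - f 1) * \<rho>],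
       [s * (f 0 - f 1) * \<rho>, (a * f 0 - b * f 1) * \<rho>]] ! i ! j)" for f
  proof (rule eq_matI)
    let ?N = "Matrix.mat 2 2 (\<lambda>(i, j).
      [[(a * f 1 - b * f 0) * \<rho>, s * (f 0 - f 1) * \<rho>],
       [s * (f 0 - f 1) * \<rho>, (a * f 0 - b * f 1) * \<rho>]] ! i ! j)"
    fix i j assume "i < dim_row ?N" "j < dim_col ?N"
    then have ij: "i = 0 \<or> i = 1" "j = 0 \<or> j = 1" by auto
    have "s * f 0 * (- s * b * \<rho>) + s * f 1 * (s * a * \<rho>) = (a * f 1 - b * f 0) * \<rho>"
      using s by Groebner_Basis.algebra
    moreover have "s * f 0 * \<rho> + s * f 1 * - \<rho> = s * (f 0 - f 1) * \<rho>"
      by Groebner_Basis.algebra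
    \<comment> \<open>From a b = -1 the eigenvectors (s, a) and (s, b) are orthogonal, which makes
      \<Phi> f symmetric.\<close>
    moreover have "a * f 0 * (- s * b * \<rho>) + b * f 1 * (s * a * \<rho>) = s * (f 0 - f 1) * \<rho>"
      using ab(1) by Groebner_Basis.algebra
    moreover have "a * f 0 * \<rho> + b * f 1 * - \<rho> = (a * f 0 - b * f 1) * \<rho>"
      by Groebner_Basis.algebra
    ultimately show "\<Phi> f $$ (i, j) = ?N $$ (i, j)" using ij
      unfolding \<Phi>_def mat_diag_mult_right[OF R(1)]
      by (auto simp: R_def R'_def scalar_prod_def sum2)
  qed (simp_all add: \<Phi>_def R_def R'_def)
  \<comment> \<open>Both the eigenvalues of P(\<eta>), as M_0 = s I and M_1 has eigenvalues
    \<open>a\<close> and \<open>b\<close>, and the inner products of \<eta> with the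
    eigenvectors.\<close>
  define p where "p \<eta> i = s * \<eta> $ 0 + [a, b] ! i * \<eta> $ 1" for \<eta> :: "real vec" and i
  have P\<Phi>: "galerkin_matrix M \<xi> \<psi> 1 \<eta> = \<Phi> (p \<eta>)" for \<eta>
  proof -
    define x y where "x = \<eta> $ 0" "y = \<eta> $ 1"
    have "s * x = (a * (s * x + b * y) - b * (s * x + a * y)) * \<rho>"
      using ab(3) by Groebner_Basis.algebra
    moreover have "s * y = s * ((s * x + a * y) - (s * x + b * y)) * \<rho>"
      using ab(3) by Groebner_Basis.algebra
    moreover have "s * x + t * y = (a * (s * x + a * y) - b * (s * x + b * y)) * \<rho>"
      using ab(2,3) by Groebner_Basis.algebra
    ultimately show ?thesis
      unfolding P \<Phi> p_def x_y_def by (intro eq_matI) (auto simp: lt2)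
  qed
  define H where "H = galerkin_matrix M \<xi> \<psi> 1 (component 1 0 W)"
  have pos: "p (component 1 0 W) i > 0" if "i < 2" for i
  proof -
    define x y z where "x = component 1 0 W $ 0" "y = component 1 0 W $ 1" "z = [a, b] ! i"
    \<comment> \<open>Testing positive definiteness on the eigenvector (s, z) gives its eigenvalue
      times its squared length 1 + z^2.\<close>
    define v where "v = Matrix.vec 2 (\<lambda>k. [s, z] ! k)"
    have z: "z * z = 1 + t * z"
    proof -
      have "z = a \<or> z = b" using that by (auto simp: x_y_z_def lt2)
      then show ?thesis using ab by (auto simp: algebra_simps)
    qed
    have "s \<noteq> 0" using s by auto
    then have "v \<noteq> 0\<^sub>v 2"
      by (auto simp: v_def vec_eq_iff lt2)
    moreover have "H \<in> carrier_mat 2 2" "v \<in> carrier_vec 2"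
      by (simp_all add: H_def P v_def del: One_nat_def)
    moreover have "positive_definite H"
      using W by (simp add: sgswlme_states_def Let_def H_def)
    ultimately have "v \<bullet> (H *\<^sub>v v) > 0"
      by (auto simp: positive_definite_def)
    also have "v \<bullet> (H *\<^sub>v v) = s * (s * x * s + s * y * z) + z * (s * y * s + (s * x + t * y) * z)"
      unfolding H_def P v_def x_y_z_def by (simp add: scalar_prod_def sum2 algebra_simps)
    also have "\<dots> = (s * x + z * y) * (1 + z * z)"
      using s z by Groebner_Basis.algebra
    finally have "0 < (s * x + z * y) * (1 + z * z)" .
    moreover have "0 < 1 + z * z" by (simp add: add_pos_nonneg)
    ultimately have "0 < s * x + z * y" by (rule zero_less_mult_pos2)
    then show ?thesis by (simp add: p_def x_y_z_def)
  qed
  \<comment> \<open>By symmetry of \<Phi>, each functional \<open>p _ i\<close> is a left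
    eigenvector, so it turns application of \<Phi>(1/h) into division by \<open>h i\<close>.\<close>
  have inv: "galerkin_matrix M \<xi> \<psi> 1 (\<Phi> (\<lambda>i. 1 / h i) *\<^sub>v q) = \<Phi> (\<lambda>i. p q i / h i)"
    if q: "q \<in> carrier_vec 2" for q h
  proof -
    \<comment> \<open>Naming the reciprocals leaves polynomial identities modulo the relations
      between \<open>s\<close>, \<open>a\<close>, \<open>b\<close> and \<rho>.\<close>
    define x y k l where "x = q $ 0" "y = q $ 1" "k = 1 / h 0" "l = 1 / h 1"
    note xykl = this
    have w: "(\<Phi> (\<lambda>i. 1 / h i) *\<^sub>v q) $ 0 = (a * l - b * k) * \<rho> * x + s * (k - l) * \<rho> * y"
      "(\<Phi> (\<lambda>i. 1 / h i) *\<^sub>v q) $ 1 = s * (k - l) * \<rho> * x + (a * k - b * l) * \<rho> * y"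
      using q by (simp_all add: \<Phi> scalar_prod_def sum2 xykl)
    have "s * ((a * l - b * k) * \<rho> * x + s * (k - l) * \<rho> * y)
        + a * (s * (k - l) * \<rho> * x + (a * k - b * l) * \<rho> * y) = (s * x + a * y) * k"
      "s * ((a * l - b * k) * \<rho> * x + s * (k - l) * \<rho> * y)
        + b * (s * (k - l) * \<rho> * x + (a * k - b * l) * \<rho> * y) = (s * x + b * y) * l"
      using s ab(1,3) by Groebner_Basis.algebra+
    then have "p (\<Phi> (\<lambda>i. 1 / h i) *\<^sub>v q) i = p q i / h i" if "i < 2" for i
      using that unfolding lt2 p_def w by (auto simp: xykl)
    then show ?thesis
      unfolding P\<Phi> by (simp add: \<Phi>)
  qed
  have q: "component 1 i W \<in> carrier_vec 2" for i by (simp add: component_def)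
  show ?thesis
    by (rule sgswlme_matrix_similar_diagonal[where n = 2, OF _ R RR' R'R])
      (unfold \<Phi>_def[symmetric], auto simp del: One_nat_def simp: inv[OF q] intro: P\<Phi> pos g)
qed

theorem theorem5p2:
  fixes M :: "'a measure" and \<nu> \<xi> :: "'a \<Rightarrow> real"
    and \<psi> :: "nat \<Rightarrow> real poly" and \<alpha> \<beta> \<gamma> :: "nat \<Rightarrow> real"
    and \<mu> \<sigma> slip g :: real and K :: nat
  assumes "prob_space M"
    and "\<sigma> > 0" and "slip > 0" and "g > 0"
    and "\<forall>\<omega> \<in> space M. \<nu> \<omega> = \<mu> + \<sigma> * \<xi> \<omega>"
    and "uniform_friction M \<nu> \<mu> \<sigma> \<or> normal_friction M \<nu> \<mu> \<sigma>"
    and "orthonormal_polys M \<xi> \<psi>"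
    and "three_term_recurrence \<psi> \<alpha> \<beta> \<gamma>"
    and "K \<le> 10"
  shows "hyperbolic
    (if K > 1 then linearised K (sgswlme M \<xi> \<psi> \<alpha> \<beta> \<gamma> \<mu> \<sigma> slip g K)
     else sgswlme M \<xi> \<psi> \<alpha> \<beta> \<gamma> \<mu> \<sigma> slip g K)"
proof -
  \<comment> \<open>Only the argument of the matrix is truncated; the state itself still ranges over
    the full set of states.\<close>
  let ?A = "\<lambda>W. sgswlme_matrix M \<xi> \<psi> g K (if K > 1 then drop_higher_modes K W else W)"
  have "\<exists>D. diagonal_mat D \<and> similar_mat (?A W) D" if W: "W \<in> sgswlme_states M \<xi> \<psi> K" for W
  proof -
    consider "K = 0" | "K = 1" | "K > 1" by linarith
    then show ?thesis
    proof cases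
      \<comment> \<open>With K = 0 there are no higher modes, so the state already has the truncated
        form.\<close>
      case 1
      with assms(1,4,7) W show ?thesis
        by (simp add: sgswlme_matrix_constant_similar_diagonal[where W = W])
    next
      case 2
      with assms(1,4,7) W show ?thesis
        using sgswlme_matrix_order_one_similar_diagonal by simp
    next
      case 3
      have "drop_higher_modes K W $ (i * (K + 1) + k) = 0" if "i < 3" "0 < k" "k \<le> K" for i k
      proof -
        \<comment> \<open>This bound keeps the index inside the vector, where the entries of
          \<open>drop_higher_modes\<close> are given by their defining formula.\<close>
        have "i * (K + 1) \<le> 2 * (K + 1)" using that(1) by (intro mult_right_mono) auto
        then have "i * (K + 1) + k < 3 * (K + 1)" using that(3) by simp
        moreover have "(i * (K + 1) + k) mod (K + 1) = k" using that(3) by (subst mod_mult_self3) simp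
        ultimately show ?thesis using that(2) by (simp add: drop_higher_modes_def del: mod_mult_self3)
      qed
      moreover have "drop_higher_modes K W $ 0 = W $ 0" by (simp add: drop_higher_modes_def)
      ultimately show ?thesis
        using sgswlme_matrix_constant_similar_diagonal[OF assms(1,7,4) W] 3 by simp
    qed
  qed
  then have "diagonalisable (map_mat complex_of_real (?A W)) \<and>
      (\<forall>z. eigenvalue (map_mat complex_of_real (?A W)) z \<longrightarrow> z \<in> \<real>)"
    if "W \<in> sgswlme_states M \<xi> \<psi> K" for W
    using that similar_real_diagonal_hyperbolic by blast
  then show ?thesis
    by (auto simp: hyperbolic_def Let_def linearised_def sgswlme_def split: if_splits)
qed

end
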